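(* Let $p_1 < p_2 < \cdots < p_\omega$ be given fixed distinct primes. Then the class $C_{p_1 \cdots p_\omega}$ of all abc-equations with radical $p_1 p_2 \cdots p_\omega$ contains only a finite number of abc-equations. That is, there are only finitely many triples $(a,b,c)$ of positive integers with $c = a+b$, $1 \le a < b$, $\gcd(a,b)=1$ and $\prod_{p \mid abc} p = p_1 p_2 \cdots p_\omega$ (product over the distinct primes $p$ dividing $abc$).
   Context: An abc-equation is an integer equation $E: c = a+b$ with $1 \le a < b$ and $\gcd(a,b)=1$. Its radical is $R(E) = R(abc) = \prod_{p \mid abc} p$, the product of the distinct primes dividing $abc$, written $p_1 p_2 \cdots p_\omega$ with $p_1 < p_2 < \cdots < p_\omega$ (necessarily $p_1 = 2$). The class $C_{p_1\cdots p_\omega}$ is the set of all abc-equations whose radical equals $p_1 p_2 \cdots p_\omega$. *)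

theory Defs
  imports "HOL-Number_Theory.Number_Theory"
begin

text \<open>The equation \<open>c = a + b\<close> is represented by the triple \<open>(a, b, c)\<close>.\<close>

definition abc_equation :: "nat \<times> nat \<times> nat \<Rightarrow> bool" where
  "abc_equation = (\<lambda>(a, b, c). c = a + b \<and> 1 \<le> a \<and> a < b \<and> gcd a b = 1)"

definition abc_radical :: "nat \<times> nat \<times> nat \<Rightarrow> nat" where
  "abc_radical = (\<lambda>(a, b, c). \<Prod>p\<in>prime_factors (a * b * c). p)"

definition abc_class :: "nat \<Rightarrow> (nat \<times> nat \<times> nat) set" where
  "abc_class r = {E. abc_equation E \<and> abc_radical E = r}"

end

theory Submission
  imports Defs "HOL-Analysis.Analysis"
begin

text \<open>
  The argument follows Beukers and Schlickewei. Splitting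
  \<open>\<integral> t\<^sup>p (a - t)\<^sup>q (c - t)\<^sup>r dt\<close> over \<open>[0, c]\<close> at \<open>a\<close> gives, for every solution of \<open>a + b = c\<close>
  and every \<open>m\<close>, two independent pairs of integers \<open>(P, Q)\<close> of size at most \<open>(32 c)\<^sup>m\<close> such that
  \<open>c\<close> to the power \<open>n = 2 m\<close> divides \<open>a\<^sup>n P + b\<^sup>n Q\<close>.
  Attach to a solution the vector of exponents of the given primes in \<open>a\<close>, \<open>b\<close>, \<open>c\<close>, weighted by
  \<open>ln p\<close>. If there are infinitely many solutions, then by compactness there are two, \<open>(a, b, c)\<close>
  with \<open>c\<close> large and \<open>(A, B, C)\<close> with \<open>C\<close> much larger, whose vectors point in nearly the same
  direction. With \<open>n\<close> about \<open>ln C / ln c\<close>, the entries \<open>A\<close>, \<open>B\<close>, \<open>C\<close> are then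
  \<open>a\<^sup>n U\<close>, \<open>b\<^sup>n V\<close>, \<open>c\<^sup>n W\<close> up to a common factor, with \<open>U\<close> and \<open>V\<close> small positive
  integers. So \<open>c\<^sup>n\<close> divides \<open>a\<^sup>n U + b\<^sup>n V\<close>, hence also a nonzero determinant
  \<open>U Q - V P\<close>, which is too small for that.
\<close>

section \<open>Beta integrals and forms with integer coefficients\<close>

lemma has_integral_power_beta:
  "((\<lambda>t::real. t ^ p * (1 - t) ^ q) has_integral fact p * fact q / fact (p + q + 1)) {0..1}"
proof -
  have "((\<lambda>t. t powr (real (p + 1) - 1) * (1 - t) powr (real (q + 1) - 1)) has_integral
      Beta (real (p + 1)) (real (q + 1))) {0..1}"
    by (intro has_integral_Beta_real) auto
  moreover have "Beta (real (p + 1)) (real (q + 1)) = fact p * fact q / fact (p + q + 1)"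
  proof -
    have G: "Gamma (real (k + 1)) = fact k" for k
      using Gamma_fact[of k, where 'a = real] by (simp add: add.commute)
    have "real (p + 1) + real (q + 1) = real (p + q + 1 + 1)" by simp
    then show ?thesis unfolding Beta_def by (simp only: G)
  qed
  ultimately have "((\<lambda>t. t powr (real (p + 1) - 1) * (1 - t) powr (real (q + 1) - 1)) has_integral
      fact p * fact q / fact (p + q + 1)) {0..1}"
    by (simp only:)
  \<comment> \<open>\<open>0 powr 0\<close> is 0 while \<open>0 ^ 0\<close> is 1, so the integrands
    may differ at the two endpoints, which the integral ignores.\<close>
  then show ?thesis
  proof (rule has_integral_spike_finite[of "{0, 1}", rotated 2])
    fix t :: real assume "t \<in> {0..1} - {0, 1}"
    then have "t > 0" "1 - t > 0" by auto
    then show "t ^ p * (1 - t) ^ q = t powr (real (p + 1) - 1) * (1 - t) powr (real (q + 1) - 1)"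
      by (simp add: powr_realpow)
  qed simp
qed

text \<open>Up to the factor \<open>p! q! r! / (p + q + r + 1)!\<close>, this is the integral of
  \<open>s\<^sup>p (1 - s)\<^sup>q (x (1 - s) + w s)\<^sup>r\<close> over \<open>[0, 1]\<close>; unlike the integral it has integer
  coefficients.\<close>
definition beta_form :: "nat \<Rightarrow> nat \<Rightarrow> nat \<Rightarrow> 'a \<Rightarrow> 'a \<Rightarrow> 'a::comm_semiring_1" where
  "beta_form p q r x w =
     (\<Sum>k\<le>r. of_nat ((p + k) choose p) * of_nat ((q + (r - k)) choose q) * x ^ (r - k) * w ^ k)"

lemma beta_form_swap: "beta_form p q r x w = beta_form q p r w x"
  unfolding beta_form_def atMost_atLeast0
  by (subst sum.atLeastAtMost_rev) (auto intro!: sum.cong simp: mult_ac)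

lemma of_int_beta_form:
  "of_int (beta_form p q r x w) = beta_form p q r (of_int x) (of_int w)"
  by (simp add: beta_form_def)

text \<open>Both sides equal \<open>fact r * fact (p + k) * fact (q + (r - k)) / (fact k * fact (r -
  k))\<close>; this is why only integers remain once the common factorials leave the
  integral.\<close>

lemma beta_form_coeff:
  assumes "k \<le> r"
  shows "of_nat (r choose k) * (fact (p + k) * fact (q + (r - k)))
       = (fact p * fact q * fact r * of_nat ((p + k) choose p) * of_nat ((q + (r - k)) choose q) :: real)"
  using assms by (simp add: binomial_fact field_simps)

lemma has_integral_beta_form:
  fixes x w :: real
  shows "((\<lambda>s. s ^ p * (1 - s) ^ q * (x * (1 - s) + w * s) ^ r) has_integral
     fact p * fact q * fact r / fact (p + q + r + 1) * beta_form p q r x w) {0..1}"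
proof -
  have "((\<lambda>s. \<Sum>k\<le>r. of_nat (r choose k) * w ^ k * x ^ (r - k) * (s ^ (p + k) * (1 - s) ^ (q + (r - k))))
     has_integral (\<Sum>k\<le>r. of_nat (r choose k) * w ^ k * x ^ (r - k) *
        (fact (p + k) * fact (q + (r - k)) / fact (p + k + (q + (r - k)) + 1)))) {0..1}"
    by (intro has_integral_sum has_integral_mult_right has_integral_power_beta) auto
  also have "(\<lambda>s. \<Sum>k\<le>r. of_nat (r choose k) * w ^ k * x ^ (r - k) * (s ^ (p + k) * (1 - s) ^ (q + (r - k))))
      = (\<lambda>s. s ^ p * (1 - s) ^ q * (x * (1 - s) + w * s) ^ r)"
  proof
    fix s :: real
    have "(x * (1 - s) + w * s) ^ r = (w * s + x * (1 - s)) ^ r"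
      by (simp add: add.commute)
    also have "\<dots> = (\<Sum>k\<le>r. of_nat (r choose k) * (w * s) ^ k * (x * (1 - s)) ^ (r - k))"
      by (rule binomial_ring)
    finally show "(\<Sum>k\<le>r. of_nat (r choose k) * w ^ k * x ^ (r - k) * (s ^ (p + k) * (1 - s) ^ (q + (r - k))))
      = s ^ p * (1 - s) ^ q * (x * (1 - s) + w * s) ^ r"
      by (simp only: sum_distrib_left power_mult_distrib power_add mult_ac)
  qed
  also have "(\<Sum>k\<le>r. of_nat (r choose k) * w ^ k * x ^ (r - k) *
        (fact (p + k) * fact (q + (r - k)) / fact (p + k + (q + (r - k)) + 1)))
      = fact p * fact q * fact r / fact (p + q + r + 1) * beta_form p q r x w"
    unfolding beta_form_def sum_distrib_left
  proof (rule sum.cong)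
    fix k assume "k \<in> {..r}"
    then have k: "k \<le> r" by simp
    have e: "p + k + (q + (r - k)) + 1 = p + q + r + 1" using k by simp
    show "of_nat (r choose k) * w ^ k * x ^ (r - k) *
        (fact (p + k) * fact (q + (r - k)) / fact (p + k + (q + (r - k)) + 1)) =
       fact p * fact q * fact r / fact (p + q + r + 1) *
        (of_nat ((p + k) choose p) * of_nat ((q + (r - k)) choose q) * x ^ (r - k) * w ^ k)"
      unfolding e
      using arg_cong[OF beta_form_coeff[OF k, of p q], of "\<lambda>y. y * w ^ k * x ^ (r - k) / fact (p + q + r + 1)"]
      by (simp add: mult_ac)
  qed simp
  finally show ?thesis .
qed

lemma has_integral_rescale:
  fixes f :: "real \<Rightarrow> real"
  assumes "(f has_integral i) {u..u + h}" and "h > 0"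
  shows "((\<lambda>s. h * f (u + h * s)) has_integral i) {0..1}"
proof -
  have "((\<lambda>x. f (h *\<^sub>R x + u)) has_integral (i /\<^sub>R h ^ DIM(real)))
           (cbox ((u - u) /\<^sub>R h) ((u + h - u) /\<^sub>R h))"
    using assms by (intro has_integral_affinity') auto
  then have "((\<lambda>x. f (u + h * x)) has_integral (i / h)) {0..1}"
    using assms by (simp add: divide_inverse mult.commute add.commute)
  from has_integral_mult_right[OF this, of h] show ?thesis
    using assms by simp
qed

text \<open>The integral of \<open>t\<^sup>p (a - t)\<^sup>q (c - t)\<^sup>r\<close> over \<open>[0, c]\<close> is the sum
  of those over \<open>[0, a]\<close> and \<open>[a, c]\<close>; each is a power times a \<open>beta_form\<close>.\<close>
lemma beta_form_identity:
  fixes a b c :: real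
  assumes "a > 0" "b > 0" and c: "c = a + b"
  shows "a ^ (p + q + 1) * beta_form p q r c b + (-1) ^ q * b ^ (q + r + 1) * beta_form r q p c a
       = c ^ (p + r + 1) * beta_form p r q a (- b)"
proof -
  define f where "f = (\<lambda>t. t ^ p * (a - t) ^ q * (c - t) ^ r)"
  define C :: real where "C = fact p * fact q * fact r / fact (p + q + r + 1)"
  have "C \<noteq> 0" by (simp add: C_def)
  have int: "f integrable_on {u..v}" for u v
    unfolding f_def by (intro integrable_continuous_real continuous_intros)
  note I = integrable_integral[OF int]
  have "((\<lambda>s. a ^ (p + q + 1) * (s ^ p * (1 - s) ^ q * (c * (1 - s) + b * s) ^ r)) has_integral
      integral {0..a} f) {0..1}"
  proof -
    have e: "a * f (0 + a * s) = a ^ (p + q + 1) * (s ^ p * (1 - s) ^ q * (c * (1 - s) + b * s) ^ r)" for s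
    proof -
      have "a - a * s = a * (1 - s)" "c - a * s = c * (1 - s) + b * s"
        by (auto simp: c algebra_simps)
      then show ?thesis
        by (simp add: f_def power_add power_mult_distrib mult_ac)
    qed
    have "((\<lambda>s. a * f (0 + a * s)) has_integral integral {0..a} f) {0..1}"
      using I[of 0 a] assms by (intro has_integral_rescale) auto
    then show ?thesis by (simp only: e)
  qed
  then have 1: "integral {0..a} f = a ^ (p + q + 1) * (C * beta_form p q r c b)"
    unfolding C_def
    by (rule has_integral_unique) (intro has_integral_mult_right has_integral_beta_form)
  \<comment> \<open>On [a, c] the factor \<open>a - t\<close> is negative: with t = a + b s it is -b
    s, whence the sign \<open>(-1) ^ q\<close>.\<close>
  have "((\<lambda>s. (-1) ^ q * b ^ (q + r + 1) * (s ^ q * (1 - s) ^ r * (a * (1 - s) + c * s) ^ p)) has_integral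
      integral {a..c} f) {0..1}"
  proof -
    have e: "b * f (a + b * s) = (-1) ^ q * b ^ (q + r + 1) * (s ^ q * (1 - s) ^ r * (a * (1 - s) + c * s) ^ p)" for s
    proof -
      have "a - (a + b * s) = (-1) * (b * s)" "c - (a + b * s) = b * (1 - s)"
           "a + b * s = a * (1 - s) + c * s"
        by (auto simp: c algebra_simps)
      then show ?thesis
        unfolding f_def by (simp only: power_add power_mult_distrib mult_ac power_one_right)
    qed
    have "((\<lambda>s. b * f (a + b * s)) has_integral integral {a..c} f) {0..1}"
      using I[of a c] assms by (intro has_integral_rescale) auto
    then show ?thesis by (simp only: e)
  qed
  then have "integral {a..c} f = (-1) ^ q * b ^ (q + r + 1) *
      (fact q * fact r * fact p / fact (q + r + p + 1) * beta_form q r p a c)"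
    by (rule has_integral_unique) (intro has_integral_mult_right has_integral_beta_form)
  then have 2: "integral {a..c} f = (-1) ^ q * b ^ (q + r + 1) * (C * beta_form r q p c a)"
    by (simp add: C_def beta_form_swap[of q] add_ac mult_ac)
  \<comment> \<open>Over all of [0, c] the factor that changes sign is the linear form a (1 - s) - b
    s, so the resulting form has a negative argument.\<close>
  have "((\<lambda>s. c ^ (p + r + 1) * (s ^ p * (1 - s) ^ r * (a * (1 - s) + (- b) * s) ^ q)) has_integral
      integral {0..c} f) {0..1}"
  proof -
    have e: "c * f (0 + c * s) = c ^ (p + r + 1) * (s ^ p * (1 - s) ^ r * (a * (1 - s) + (- b) * s) ^ q)" for s
    proof -
      have "c - c * s = c * (1 - s)" "a - c * s = a * (1 - s) + (- b) * s"
        by (auto simp: c algebra_simps)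
      then show ?thesis
        unfolding f_def by (simp only: add_0 power_add power_mult_distrib mult_ac power_one_right)
    qed
    have "((\<lambda>s. c * f (0 + c * s)) has_integral integral {0..c} f) {0..1}"
      using I[of 0 c] assms by (intro has_integral_rescale) auto
    then show ?thesis by (simp only: e)
  qed
  then have "integral {0..c} f = c ^ (p + r + 1) *
      (fact p * fact r * fact q / fact (p + r + q + 1) * beta_form p r q a (- b))"
    by (rule has_integral_unique) (intro has_integral_mult_right has_integral_beta_form)
  then have 3: "integral {0..c} f = c ^ (p + r + 1) * (C * beta_form p r q a (- b))"
    by (simp add: C_def add_ac mult_ac)
  have "integral {0..a} f + integral {a..c} f = integral {0..c} f"
    using assms int by (intro Henstock_Kurzweil_Integration.integral_combine) auto
  then have "C * (a ^ (p + q + 1) * beta_form p q r c b + (-1) ^ q * b ^ (q + r + 1) * beta_form r q p c a)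
      = C * (c ^ (p + r + 1) * beta_form p r q a (- b))"
    unfolding 1 2 3 by (simp only: ring_distribs mult_ac)
  then show ?thesis using \<open>C \<noteq> 0\<close> by simp
qed

text \<open>The cofactor \<open>beta_form p r q a (- b)\<close> is an integer, so the real identity,
  read at integers, becomes a divisibility.\<close>

lemma beta_form_dvd:
  fixes a b c :: int
  assumes "a > 0" "b > 0" and c: "c = a + b"
  shows "c ^ (p + r + 1) dvd
     a ^ (p + q + 1) * beta_form p q r c b + (-1) ^ q * b ^ (q + r + 1) * beta_form r q p c a"
proof -
  have "real_of_int (a ^ (p + q + 1) * beta_form p q r c b + (-1) ^ q * b ^ (q + r + 1) * beta_form r q p c a)
      = real_of_int (c ^ (p + r + 1) * beta_form p r q a (- b))"
    using beta_form_identity[of "real_of_int a" "real_of_int b" "real_of_int c" p q r] assms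
    by (simp add: of_int_beta_form)
  then show ?thesis
    unfolding of_int_eq_iff by simp
qed

section \<open>Positivity and size of the forms\<close>

lemma beta_form_pos:
  fixes x w :: int
  assumes "x > 0" "w > 0"
  shows "beta_form p q r x w > 0"
  unfolding beta_form_def using assms by (intro sum_pos) auto

text \<open>The two binomials in each term contribute at most \<open>2 ^ (p + q + 2 * r)\<close>;
  the number of terms, \<open>r + 1\<close>, is at most \<open>2 ^ r\<close>.\<close>

lemma beta_form_le:
  fixes x w :: int
  assumes "0 < x" "0 < w" "w \<le> x"
  shows "beta_form p q r x w \<le> 2 ^ (p + q + 3 * r) * x ^ r"
proof -
  have "beta_form p q r x w \<le> (\<Sum>k\<le>r. 2 ^ (p + r) * 2 ^ (q + r) * x ^ (r - k) * x ^ k)"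
    unfolding beta_form_def
  proof (intro sum_mono mult_mono power_mono)
    have ch: "int (n choose k) \<le> 2 ^ l" if "n \<le> l" for n k l
    proof -
      have "n choose k \<le> 2 ^ n" by (rule binomial_le_pow2)
      also have "\<dots> \<le> 2 ^ l" using that by (intro power_increasing) auto
      finally have "int (n choose k) \<le> int (2 ^ l)" by (simp only: of_nat_le_iff)
      then show ?thesis by simp
    qed
    fix k assume "k \<in> {..r}"
    then show "int ((p + k) choose p) \<le> 2 ^ (p + r)" "int ((q + (r - k)) choose q) \<le> 2 ^ (q + r)"
      by (intro ch; simp)+
  qed (use assms in auto)
  also have "\<dots> = (\<Sum>k\<le>r. 2 ^ (p + q + 2 * r) * x ^ r)"
  proof (intro sum.cong)
    fix k assume "k \<in> {..r}"
    then have "x ^ (r - k) * x ^ k = x ^ r" by (simp flip: power_add)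
    moreover have "(2::int) ^ (p + r) * 2 ^ (q + r) = 2 ^ (p + q + 2 * r)"
      by (simp add: power_add mult_2)
    ultimately show "2 ^ (p + r) * 2 ^ (q + r) * x ^ (r - k) * x ^ k = 2 ^ (p + q + 2 * r) * x ^ r"
      by (simp only: mult.assoc)
  qed simp
  also have "\<dots> = (int r + 1) * (2 ^ (p + q + 2 * r) * x ^ r)"
    by simp
  also have "\<dots> \<le> 2 ^ r * (2 ^ (p + q + 2 * r) * x ^ r)"
  proof (intro mult_right_mono)
    have "r + 1 \<le> 2 ^ r" using Suc_leI[OF less_exp[of r]] by simp
    then have "int (r + 1) \<le> int (2 ^ r)" by (simp only: of_nat_le_iff)
    then show "int r + 1 \<le> 2 ^ r" by simp
  qed (use assms in auto)
  also have "\<dots> = 2 ^ (p + q + 3 * r) * x ^ r"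
  proof -
    have "p + q + 3 * r = r + (p + q + 2 * r)" by simp
    then show ?thesis by (simp only: power_add mult.assoc)
  qed
  finally show ?thesis .
qed

text \<open>Multiplication by \<open>w\<close> shifts the index by one. Terms of equal degree then
  compare through a ratio (k + 1) / (j + 1) of binomials, and the unmatched term in
  \<open>x ^ Suc j\<close> makes the inequality strict. This later separates the two pairs (P,
  Q).\<close>

lemma beta_form_shift_less:
  fixes x w :: int
  assumes "x > 0" "w > 0"
  shows "w * beta_form (Suc j) q j x w < beta_form j q (Suc j) x w"
proof -
  have "w * beta_form (Suc j) q j x w
     = (\<Sum>k\<le>j. int (Suc (j + k) choose Suc j) * int ((q + (j - k)) choose q) * x ^ (j - k) * w ^ Suc k)"
    unfolding beta_form_def sum_distrib_left by (simp add: mult_ac)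
  also have "\<dots> \<le> (\<Sum>k\<le>j. int (Suc (j + k) choose j) * int ((q + (j - k)) choose q) * x ^ (j - k) * w ^ Suc k)"
  proof (intro sum_mono mult_right_mono)
    fix k assume "k \<in> {..j}"
    then have k: "k \<le> j" by simp
    have "Suc j * (Suc (j + k) choose Suc j) = Suc k * (Suc (j + k) choose j)"
    proof -
      have "Suc k * (Suc (j + k) choose Suc k) = Suc (j + k) * (j + k choose k)"
        using Suc_times_binomial_eq[of "j + k" k] by (simp add: mult_ac)
      moreover have "Suc j * (Suc (j + k) choose Suc j) = Suc (j + k) * (j + k choose j)"
        using Suc_times_binomial_eq[of "j + k" j] by (simp add: mult_ac)
      moreover have "(j + k choose k) = (j + k choose j)"
        using binomial_symmetric[of k "j + k"] by simp
      moreover have "(Suc (j + k) choose Suc k) = (Suc (j + k) choose j)"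
        using binomial_symmetric[of "Suc k" "Suc (j + k)"] by simp
      ultimately show ?thesis by simp
    qed
    also have "\<dots> \<le> Suc j * (Suc (j + k) choose j)"
      using k by (intro mult_right_mono) auto
    finally show "int (Suc (j + k) choose Suc j) \<le> int (Suc (j + k) choose j)"
      by (simp only: Suc_mult_le_cancel1 of_nat_le_iff)
  qed (use assms in auto)
  also have "\<dots> < int ((q + Suc j) choose q) * x ^ Suc j + \<dots>"
    using assms by simp
  also have "\<dots> = beta_form j q (Suc j) x w"
    unfolding beta_form_def sum.atMost_Suc_shift by simp
  finally show ?thesis .
qed

section \<open>A bound on \<open>c ^ m\<close> from a relation between powers\<close>

text \<open>Two congruences \<open>a\<^sup>n U + b\<^sup>n V \<equiv> 0\<close> and \<open>a\<^sup>n P + b\<^sup>n Q \<equiv> 0\<close> modulo \<open>c\<^sup>n\<close>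
  make \<open>c\<^sup>n\<close> divide the determinant \<open>U Q - V P\<close>.\<close>
lemma power_le_if_nonproportional:
  fixes a b c U V P Q K :: int
  assumes "coprime a c" "c > 0" "U > 0" "V > 0"
    and UV: "c ^ n dvd a ^ n * U + b ^ n * V" and PQ: "c ^ n dvd a ^ n * P + b ^ n * Q"
    and ne: "U * Q \<noteq> V * P" and K: "\<bar>P\<bar> \<le> K" "\<bar>Q\<bar> \<le> K"
  shows "c ^ n \<le> K * (U + V)"
proof -
  have "c ^ n dvd (a ^ n * U + b ^ n * V) * Q - (a ^ n * P + b ^ n * Q) * V"
    using UV PQ by (intro dvd_diff dvd_mult2)
  also have "\<dots> = a ^ n * (U * Q - V * P)" by (simp add: algebra_simps)
  finally have "c ^ n dvd a ^ n * (U * Q - V * P)" .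
  moreover have "coprime (c ^ n) (a ^ n)" using assms by (simp add: coprime_commute)
  ultimately have "c ^ n dvd U * Q - V * P" using coprime_dvd_mult_right_iff by blast
  then have "c ^ n \<le> \<bar>U * Q - V * P\<bar>"
    using ne by (intro zdvd_imp_le) auto
  also have "\<dots> \<le> U * \<bar>Q\<bar> + V * \<bar>P\<bar>"
    using assms abs_triangle_ineq4[of "U * Q" "V * P"] by (simp add: abs_mult)
  also have "\<dots> \<le> U * K + V * K"
    using assms by (intro add_mono mult_left_mono) auto
  finally show ?thesis by (simp add: algebra_simps)
qed

text \<open>\<open>beta_form_dvd\<close> with p = q = m and r = m - 1, applied to (a, b) and to (b,
  a), gives two pairs of coefficients with nonzero determinant. So (U, V) is not proportional to one
  of them, and that one yields the bound after cancelling \<open>c ^ m\<close>.\<close>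

lemma power_le_of_power_relation:
  fixes a b c U V :: int
  assumes a: "a > 0" and b: "b > 0" and c: "c = a + b" and cop: "coprime a b"
    and U: "U > 0" and V: "V > 0" and m: "m > 0"
    and dvd: "c ^ (2 * m) dvd a ^ (2 * m) * U + b ^ (2 * m) * V"
  shows "c ^ m \<le> 32 ^ m * (U + V)"
proof -
  obtain j where j: "m = Suc j" using m by (cases m) auto
  define f where "f = beta_form (Suc j) (Suc j) j c"
  define g where "g = beta_form j (Suc j) (Suc j) c"
  have c0: "c > 0" using a b c by simp
  have cac: "coprime a c" using cop by (simp add: c coprime_iff_gcd_eq_1)
  have lt: "x * f x < g x" if "x > 0" for x
    unfolding f_def g_def using c0 that by (rule beta_form_shift_less)
  have fpos: "f x > 0" if "x > 0" for x
    unfolding f_def using c0 that by (rule beta_form_pos)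
  have gpos: "g x > 0" if "x > 0" for x
    unfolding g_def using c0 that by (rule beta_form_pos)
  have gle: "g x \<le> 32 ^ m * c ^ m" if "x > 0" "x \<le> c" for x
  proof -
    \<comment> \<open>The exponent of 2 is 5 m - 1 here and 5 m - 3 for \<open>f\<close>; rounding
      both up to 5 m produces the base 32.\<close>
    have "g x \<le> 2 ^ (j + Suc j + 3 * Suc j) * c ^ Suc j"
      unfolding g_def using c0 that by (rule beta_form_le)
    also have "\<dots> \<le> 2 ^ (5 * m) * c ^ m"
      unfolding j using c0 by (intro mult_mono power_increasing) auto
    also have "(2::int) ^ (5 * m) = 32 ^ m" by (simp add: power_mult)
    finally show ?thesis .
  qed
  have fle: "x * f y \<le> 32 ^ m * c ^ m" if "0 < x" "x \<le> c" "0 < y" "y \<le> c" for x y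
  proof -
    have "f y \<le> 2 ^ (Suc j + Suc j + 3 * j) * c ^ j"
      unfolding f_def using c0 that by (intro beta_form_le)
    also have "\<dots> \<le> 2 ^ (5 * m) * c ^ j"
      unfolding j using c0 by (intro mult_right_mono power_increasing) auto
    also have "(2::int) ^ (5 * m) = 32 ^ m" by (simp add: power_mult)
    finally have "x * f y \<le> c * (32 ^ m * c ^ j)"
      using that fpos[of y] by (intro mult_mono) auto
    then show ?thesis by (simp add: j mult_ac)
  qed
  \<comment> \<open>One exponent exceeds 2 m by one; the surplus factor is absorbed into the
    coefficient \<open>a * f b\<close>.\<close>
  have n: "Suc j + j + 1 = 2 * m" "Suc j + Suc j + 1 = Suc (2 * m)" by (auto simp: j)
  have D1: "c ^ (2 * m) dvd a ^ (2 * m) * (a * f b) + b ^ (2 * m) * ((-1) ^ m * g a)"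
    using beta_form_dvd[OF a b c, of "Suc j" j "Suc j"] unfolding n
    by (simp add: f_def g_def mult_ac j)
  have c': "c = b + a" using c by simp
  \<comment> \<open>With \<open>a\<close> and \<open>b\<close> exchanged, the factor
    \<open>(-1) ^ m\<close> moves the sign back to the coefficient of
    \<open>b ^ (2 * m)\<close>.\<close>
  have "c ^ (2 * m) dvd (-1) ^ m * (b ^ (2 * m) * (b * f a) + a ^ (2 * m) * ((-1) ^ m * g b))"
    using beta_form_dvd[OF b a c', of "Suc j" j "Suc j"] unfolding n
    by (intro dvd_mult) (simp add: f_def g_def mult_ac j)
  also have "(-1) ^ m * (b ^ (2 * m) * (b * f a) + a ^ (2 * m) * ((-1) ^ m * g b))
       = a ^ (2 * m) * g b + b ^ (2 * m) * ((-1) ^ m * (b * f a))"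
    by (cases "even m") (auto simp: algebra_simps)
  finally have D2: "c ^ (2 * m) dvd a ^ (2 * m) * g b + b ^ (2 * m) * ((-1) ^ m * (b * f a))" .
  have abs: "\<bar>(-1) ^ m * y\<bar> = \<bar>y\<bar>" for y :: int
    by (cases "even m") auto
  have "c ^ (2 * m) \<le> 32 ^ m * c ^ m * (U + V)"
  proof (cases "U * ((-1) ^ m * g a) = V * (a * f b)")
    case False
    show ?thesis
    proof (rule power_le_if_nonproportional[OF cac c0 U V dvd D1 False])
      show "\<bar>a * f b\<bar> \<le> 32 ^ m * c ^ m" 
        using fle[of a b] fpos[OF b] a b c by simp
      show "\<bar>(-1) ^ m * g a\<bar> \<le> 32 ^ m * c ^ m"
        unfolding abs using gle[of a] gpos[OF a] a b c by simp
    qed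
  next
    case True
    \<comment> \<open>Proportionality to both pairs would, after cancelling U V, contradict the
      product of \<open>lt\<close> at \<open>a\<close> and at \<open>b\<close>.\<close>
    have "U * ((-1) ^ m * (b * f a)) \<noteq> V * g b"
    proof
      assume "U * ((-1) ^ m * (b * f a)) = V * g b"
      with True have "(U * ((-1) ^ m * g a)) * (V * g b) = (V * (a * f b)) * (U * ((-1) ^ m * (b * f a)))"
        by simp
      then have "g a * g b = (a * f a) * (b * f b)"
        using U V by simp
      moreover have "(a * f a) * (b * f b) < g a * g b"
        using lt[OF a] lt[OF b] fpos[OF a] fpos[OF b] gpos[OF a] a b
        by (intro mult_strict_mono) auto
      ultimately show False by simp
    qed
    then show ?thesis
    proof (rule power_le_if_nonproportional[OF cac c0 U V dvd D2])
      show "\<bar>g b\<bar> \<le> 32 ^ m * c ^ m"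
        using gle[of b] gpos[OF b] a b c by simp
      show "\<bar>(-1) ^ m * (b * f a)\<bar> \<le> 32 ^ m * c ^ m"
        unfolding abs using fle[of b a] fpos[OF a] a b c by simp
    qed
  qed
  moreover have "c ^ (2 * m) = c ^ m * c ^ m" by (simp add: mult_2 power_add)
  ultimately have "c ^ m * c ^ m \<le> c ^ m * (32 ^ m * (U + V))"
    by (simp only: mult_ac)
  then show ?thesis using c0 by simp
qed

section \<open>Exponent vectors and their directions\<close>

lemma ln_eq_sum_multiplicity:
  fixes x :: nat
  assumes "finite S" "\<And>p. p \<in> S \<Longrightarrow> prime p" "prime_factors x \<subseteq> S" "x > 0"
  shows "ln (real x) = (\<Sum>p\<in>S. real (multiplicity p x) * ln (real p))"
proof -
  have pos: "p > 0" if "p \<in> S" for p using assms(2)[OF that] by (rule prime_gt_0_nat)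
  have "x = (\<Prod>p\<in>S. p ^ multiplicity p x)"
  proof -
    have "x = (\<Prod>p\<in>prime_factors x. p ^ multiplicity p x)"
      using assms by (intro prime_factorization_nat)
    also have "\<dots> = (\<Prod>p\<in>S. p ^ multiplicity p x)"
      using assms by (intro prod.mono_neutral_left)
        (auto simp: prime_factors_multiplicity)
    finally show ?thesis .
  qed
  then have "real x = (\<Prod>p\<in>S. real p ^ multiplicity p x)"
    by (metis (mono_tags, lifting) of_nat_prod of_nat_power prod.cong)
  then have "ln (real x) = (\<Sum>p\<in>S. ln (real p ^ multiplicity p x))"
    using pos assms(1) by (simp add: ln_prod)
  also have "\<dots> = (\<Sum>p\<in>S. real (multiplicity p x) * ln (real p))"
    using pos by (intro sum.cong) (auto simp: ln_realpow)
  finally show ?thesis .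
qed

text \<open>At each prime \<open>D\<close> supplies the exponent that \<open>X\<close> lacks; the
  hypothesis bounds the logarithmic cost by \<delta> per prime.\<close>

lemma ex_power_dvd_mult:
  fixes x X :: nat and \<delta> :: real
  assumes "finite S" and pr: "\<And>p. p \<in> S \<Longrightarrow> prime p"
    and x: "prime_factors x \<subseteq> S" "x > 0" and X: "X > 0"
    and \<delta>: "\<delta> \<ge> 0" "\<And>p. p \<in> S \<Longrightarrow>
      real n * (real (multiplicity p x) * ln (real p)) \<le> real (multiplicity p X) * ln (real p) + \<delta>"
  shows "\<exists>D>0. x ^ n dvd D * X \<and> ln (real D) \<le> card S * \<delta>"
proof -
  \<comment> \<open>Truncated subtraction gives exponent 0 where \<open>X\<close> already has enough
    factors \<open>p\<close>.\<close>
  define e where "e = (\<lambda>p. n * multiplicity p x - multiplicity p X)"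
  define D where "D = (\<Prod>p\<in>S. p ^ e p)"
  have pos: "p > 0" if "p \<in> S" for p using pr[OF that] by (rule prime_gt_0_nat)
  have D0: "D > 0" unfolding D_def using pos by (intro prod_pos) auto
  have "x ^ n dvd D * X"
  proof (rule multiplicity_le_imp_dvd)
    show "x ^ n \<noteq> 0" using x by simp
  next
    fix p :: nat assume p: "prime p"
    show "multiplicity p (x ^ n) \<le> multiplicity p (D * X)"
    proof (cases "p \<in> S")
      case True
      have "p ^ e p dvd D" unfolding D_def using True assms(1) by (intro dvd_prodI)
      then have "e p \<le> multiplicity p D"
        using D0 p by (intro multiplicity_geI) auto
      then show ?thesis
        using p D0 X x unfolding e_def
        by (simp add: prime_elem_multiplicity_mult_distrib prime_elem_multiplicity_power_distrib)
    next
      case False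
      then have "multiplicity p x = 0"
        using x p by (auto simp: prime_factors_multiplicity)
      then show ?thesis
        using p x by (simp add: prime_elem_multiplicity_power_distrib)
    qed
  qed
  moreover have "ln (real D) \<le> card S * \<delta>"
  proof -
    have "ln (real D) = (\<Sum>p\<in>S. ln (real p ^ e p))"
      unfolding D_def of_nat_prod of_nat_power using pos assms(1) by (intro ln_prod) auto
    also have "\<dots> = (\<Sum>p\<in>S. real (e p) * ln (real p))"
      using pos by (intro sum.cong) (auto simp: ln_realpow)
    also have "\<dots> \<le> (\<Sum>p\<in>S. \<delta>)"
    proof (rule sum_mono)
      fix p assume p: "p \<in> S"
      show "real (e p) * ln (real p) \<le> \<delta>"
      proof (cases "multiplicity p X \<le> n * multiplicity p x")
        case True
        then have "real (e p) = real n * real (multiplicity p x) - real (multiplicity p X)"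
          by (simp add: e_def of_nat_diff)
        then have "real (e p) * ln (real p)
            = real n * (real (multiplicity p x) * ln (real p)) - real (multiplicity p X) * ln (real p)"
          by (simp only: left_diff_distrib mult.assoc)
        then show ?thesis using \<delta>(2)[OF p] by linarith
      next
        case False
        then show ?thesis using \<delta> by (simp add: e_def)
      qed
    qed
    finally show ?thesis by simp
  qed
  ultimately show ?thesis using D0 by blast
qed

text \<open>Dividing by \<open>ln c\<close> puts the coordinates of entries up to \<open>c\<close>
  into [0, 1], so triples of different size become comparable.\<close>

definition direction :: "nat \<Rightarrow> nat \<Rightarrow> nat \<Rightarrow> real" where
  "direction c x p = real (multiplicity p x) * ln (real p) / ln (real c)"

lemma direction_bounds:
  assumes "prime p" "0 < x" "x \<le> c" "1 < c"
  shows "0 \<le> direction c x p" "direction c x p \<le> 1"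
proof -
  have p: "p > 1" using assms(1) by (rule prime_gt_1_nat)
  have "p ^ multiplicity p x \<le> x" using assms by (intro dvd_imp_le multiplicity_dvd) auto
  then have "p ^ multiplicity p x \<le> c" using assms by simp
  then have "real (p ^ multiplicity p x) \<le> real c"
    by (simp only: of_nat_le_iff)
  then have "real p ^ multiplicity p x \<le> real c"
    by (simp only: of_nat_power)
  then have "ln (real p ^ multiplicity p x) \<le> ln (real c)"
    using p assms by (subst ln_le_cancel_iff) auto
  then have "real (multiplicity p x) * ln (real p) \<le> ln (real c)"
    using p by (simp add: ln_realpow)
  moreover have "ln (real c) > 0" "real (multiplicity p x) * ln (real p) \<ge> 0"
    using p assms(4) by auto
  ultimately show "0 \<le> direction c x p" "direction c x p \<le> 1"
    unfolding direction_def by (auto intro: divide_nonneg_pos)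
qed

text \<open>The two claims bound the denominator and the size of the quotient \<open>X / x\<^sup>n\<close>.\<close>
lemma ex_cofactor:
  fixes x X c C :: nat and M :: real
  assumes S: "finite S" "\<And>p. p \<in> S \<Longrightarrow> prime p"
    and x: "prime_factors x \<subseteq> S" "0 < x" "x \<le> c" and X: "prime_factors X \<subseteq> S" "0 < X"
    and c: "1 < c" and C: "1 < C" and M: "M > 0" and n: "real n * ln c \<le> ln C"
    and close: "\<And>p. p \<in> S \<Longrightarrow> \<bar>direction c x p - direction C X p\<bar> \<le> 1 / M"
  shows "\<exists>D>0. x ^ n dvd D * X \<and> ln (real D) \<le> card S * (ln C / M)"
    and "ln X - n * ln x \<le> ln C - n * ln c + card S * (ln C / M)"
proof -
  define h H where "h = ln (real c)" and "H = ln (real C)"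
  have h: "h > 0" and H: "H > 0" using c C by (auto simp: h_def H_def)
  define v where "v = (\<lambda>y p. real (multiplicity p y) * ln (real p))"
  have v0: "v y p \<ge> 0" if "p \<in> S" for y p
    using prime_ge_1_nat[OF S(2)[OF that]] by (simp add: v_def)
  have dx: "v x p = h * direction c x p" and dX: "v X p = H * direction C X p" for p
    using h H by (auto simp: v_def direction_def h_def H_def)
  have n': "real n * h \<le> H" using n by (simp add: h_def H_def)
  have d0: "direction c x p \<ge> 0" if "p \<in> S" for p
    using v0[OF that, of x] h unfolding dx by (simp add: zero_le_mult_iff)
  show "\<exists>D>0. x ^ n dvd D * X \<and> ln (real D) \<le> card S * (ln C / M)"
  proof (rule ex_power_dvd_mult[OF S x(1,2) X(2)])
    show "0 \<le> ln (real C) / M" using H M by (simp add: H_def)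
    fix p assume p: "p \<in> S"
    have "real n * v x p = (real n * h) * direction c x p" by (simp add: dx)
    also have "\<dots> \<le> H * direction c x p" using n' d0[OF p] by (rule mult_right_mono)
    also have "\<dots> \<le> H * (direction C X p + 1 / M)"
      using close[OF p] H by (intro mult_left_mono) auto
    finally show "real n * (real (multiplicity p x) * ln (real p))
        \<le> real (multiplicity p X) * ln (real p) + ln (real C) / M"
      using dX[of p] by (simp add: v_def H_def distrib_left)
  qed
  have "ln X = (\<Sum>p\<in>S. v X p)" unfolding v_def
    by (rule ln_eq_sum_multiplicity[OF S X])
  \<comment> \<open>\<open>X\<close> is first compared with the real power of \<open>x\<close> with
    exponent H / h; passing to the integer \<open>n\<close> costs at most (H / h - n) h, because
    \<open>x\<close> is at most \<open>c\<close>.\<close>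
  also have "\<dots> \<le> (\<Sum>p\<in>S. H / h * v x p + H / M)"
  proof (rule sum_mono)
    fix p assume p: "p \<in> S"
    have "v X p \<le> H * (direction c x p + 1 / M)"
      unfolding dX using close[OF p] H by (intro mult_left_mono) auto
    then show "v X p \<le> H / h * v x p + H / M"
      using h by (simp add: dx distrib_left)
  qed
  also have "\<dots> = H / h * ln x + card S * (H / M)"
  proof -
    have "ln x = (\<Sum>p\<in>S. v x p)" unfolding v_def
      by (rule ln_eq_sum_multiplicity[OF S x(1,2)])
    then have "(\<Sum>p\<in>S. H / h * v x p) = H / h * ln x"
      by (simp only: sum_distrib_left)
    then show ?thesis by (simp add: sum.distrib)
  qed
  finally have "ln X - n * ln x \<le> (H / h - n) * ln x + card S * (H / M)"
    by (simp add: algebra_simps)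
  also have "(H / h - n) * ln x \<le> (H / h - n) * h"
    using x n' h by (intro mult_left_mono) (auto simp: h_def[symmetric] field_simps, simp add: h_def)
  also have "(H / h - n) * h = H - n * h" using h by (simp add: field_simps)
  finally show "ln X - n * ln x \<le> ln C - n * ln c + card S * (ln C / M)"
    by (simp add: h_def H_def)
qed

section \<open>Two nearly parallel solutions of very different size\<close>

text \<open>With H = ln C and h = ln c, the logarithm of \<open>c ^ m\<close> is H / 2 up to h,
  while \<open>U\<close> and \<open>V\<close> stay below exp (H / 4 + 2 h). As \<open>32 ^ m\<close>
  is at most c to the power m / 5, this is too small for
  \<open>power_le_of_power_relation\<close>.\<close>

lemma no_far_solution_in_direction:
  fixes a b c A B C :: nat and M :: real
  assumes S: "finite S" "\<And>p. p \<in> S \<Longrightarrow> prime p"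
    and abc: "c = a + b" "0 < a" "0 < b" "coprime a b"
    and ABC: "C = A + B" "0 < A" "0 < B"
    and pf: "prime_factors a \<subseteq> S" "prime_factors b \<subseteq> S" "prime_factors c \<subseteq> S"
      "prime_factors A \<subseteq> S" "prime_factors B \<subseteq> S" "prime_factors C \<subseteq> S"
    and M: "M > 0" "16 * real (card S) \<le> M"
    and close: "\<And>p. p \<in> S \<Longrightarrow> \<bar>direction c a p - direction C A p\<bar> \<le> 1 / M"
      "\<And>p. p \<in> S \<Longrightarrow> \<bar>direction c b p - direction C B p\<bar> \<le> 1 / M"
      "\<And>p. p \<in> S \<Longrightarrow> \<bar>direction c c p - direction C C p\<bar> \<le> 1 / M"
    and large: "5 * ln 32 \<le> ln (real c)" "20 * ln (real c) \<le> ln (real C)"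
  shows False
proof -
  define h H where "h = ln (real c)" and "H = ln (real C)"
  have c1: "1 < c" and C1: "1 < C" using abc ABC by auto
  have h: "h > 0" and H: "H > 0" using c1 C1 by (auto simp: h_def H_def)
  \<comment> \<open>Thus 2 m is the largest even n for which \<open>c ^ n\<close> is at most
    \<open>C\<close>, and the rounding loss H - 2 m h is below 2 h.\<close>
  define m where "m = nat \<lfloor>H / (2 * h)\<rfloor>"
  have m: "real m \<le> H / (2 * h)" "H / (2 * h) < real m + 1"
    using h H by (auto simp: m_def)
  have m': "real (2 * m) * h \<le> H" "H < 2 * (real m + 1) * h"
    using m h by (auto simp: field_simps)
  have "20 * h < 2 * (real m + 1) * h" using m' large by (simp add: h_def H_def)
  then have m10: "m \<ge> 10" using h by simp
  define \<epsilon> where "\<epsilon> = card S * (H / M)"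
  have \<epsilon>: "\<epsilon> \<le> H / 16"
    using M H by (simp add: \<epsilon>_def field_simps)
  note n = m'(1)[unfolded h_def H_def]
  have le: "a \<le> c" "b \<le> c" "c \<le> c" using abc by auto
  note ca = ex_cofactor[OF S pf(1) abc(2) le(1) pf(4) ABC(2) c1 C1 M(1) n close(1)]
  note cb = ex_cofactor[OF S pf(2) abc(3) le(2) pf(5) ABC(3) c1 C1 M(1) n close(2)]
  have "0 < c" "0 < C" using c1 C1 by auto
  note cc = ex_cofactor(1)[OF S pf(3) \<open>0 < c\<close> le(3) pf(6) \<open>0 < C\<close> c1 C1 M(1) n close(3)]
  obtain D1 where D1: "D1 > 0" "a ^ (2 * m) dvd D1 * A" "ln (real D1) \<le> \<epsilon>"
    using ca(1) by (auto simp: \<epsilon>_def H_def)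
  obtain D2 where D2: "D2 > 0" "b ^ (2 * m) dvd D2 * B" "ln (real D2) \<le> \<epsilon>"
    using cb(1) by (auto simp: \<epsilon>_def H_def)
  obtain D3 where D3: "D3 > 0" "c ^ (2 * m) dvd D3 * C" "ln (real D3) \<le> \<epsilon>"
    using cc by (auto simp: \<epsilon>_def H_def)
  \<comment> \<open>A single multiplier for all three entries preserves the equation: D C = D A + D
    B.\<close>
  define D where "D = D1 * D2 * D3"
  have D0: "D > 0" using D1 D2 D3 by (simp add: D_def)
  have lnD: "ln (real D) \<le> 3 * \<epsilon>"
    using D1 D2 D3 by (simp add: D_def ln_mult)
  have "D * A = D1 * A * (D2 * D3)" "D * B = D2 * B * (D1 * D3)" "D * C = D3 * C * (D1 * D2)"
    by (simp_all add: D_def mult_ac)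
  then have "a ^ (2 * m) dvd D * A" "b ^ (2 * m) dvd D * B" and Cd: "c ^ (2 * m) dvd D * C"
    using D1 D2 D3 by (metis dvd_mult2)+
  then obtain U V where U: "D * A = a ^ (2 * m) * U" and V: "D * B = b ^ (2 * m) * V"
    by (auto elim!: dvdE)
  have UV0: "U > 0" "V > 0" using U V D0 ABC by (auto intro!: Nat.gr0I)
  have bound: "real Y \<le> exp (H / 4 + 2 * h)"
    if Y: "D * X = x ^ (2 * m) * Y" "0 < Y" "0 < x" "0 < X"
      and X: "ln X - (2 * m) * ln x \<le> ln C - (2 * m) * ln c + card S * (ln C / M)" for x X Y :: nat
  proof -
    have "real D * real X = real x ^ (2 * m) * real Y"
      using Y(1) by (metis of_nat_mult of_nat_power)
    then have "ln (real D * real X) = ln (real x ^ (2 * m) * real Y)" by simp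
    then have "ln (real D) + ln (real X) = real (2 * m) * ln (real x) + ln (real Y)"
      using Y D0 by (simp add: ln_mult ln_realpow)
    moreover have "ln X - (2 * m) * ln x \<le> H - (2 * m) * h + \<epsilon>"
      using X by (simp add: \<epsilon>_def h_def H_def)
    \<comment> \<open>Three \<epsilon> come from \<open>D\<close>, the fourth from comparing
      \<open>X\<close> with \<open>x ^ (2 * m)\<close>.\<close>
    ultimately have "ln (real Y) \<le> 4 * \<epsilon> + (H - 2 * m * h)"
      using lnD by simp
    also have "\<dots> \<le> H / 4 + 2 * h"
    proof -
      have "2 * (real m + 1) * h = real (2 * m) * h + 2 * h" by (simp add: algebra_simps)
      then show ?thesis using \<epsilon> m'(2) by simp
    qed
    finally show ?thesis using Y by (metis ln_le_cancel_iff exp_gt_zero ln_exp of_nat_0_less_iff)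
  qed
  have Ub: "real U \<le> exp (H / 4 + 2 * h)"
    using U UV0 abc ABC ca(2) by (intro bound) auto
  have Vb: "real V \<le> exp (H / 4 + 2 * h)"
    using V UV0 abc ABC cb(2) by (intro bound) auto
  have "int c ^ m \<le> 32 ^ m * (int U + int V)"
  proof (rule power_le_of_power_relation)
    have "c ^ (2 * m) dvd a ^ (2 * m) * U + b ^ (2 * m) * V"
      using Cd unfolding ABC(1) distrib_left U V .
    then have "int (c ^ (2 * m)) dvd int (a ^ (2 * m) * U + b ^ (2 * m) * V)"
      by (simp only: int_dvd_int_iff)
    then show "int c ^ (2 * m) dvd int a ^ (2 * m) * int U + int b ^ (2 * m) * int V"
      by simp
  qed (use abc UV0 m10 in auto)
  then have "real_of_int (int c ^ m) \<le> real_of_int (32 ^ m * (int U + int V))"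
    by (simp only: of_int_le_iff)
  then have "real c ^ m \<le> 32 ^ m * (real U + real V)" by simp
  also have "\<dots> \<le> 32 ^ m * (2 * exp (H / 4 + 2 * h))"
    using Ub Vb by (intro mult_left_mono) auto
  finally have "ln (real c ^ m) \<le> ln (32 ^ m * (2 * exp (H / 4 + 2 * h)))"
    using c1 by (subst ln_le_cancel_iff) auto
  then have "real m * h \<le> real m * ln 32 + (ln 2 + (H / 4 + 2 * h))"
    using c1 by (simp add: ln_mult ln_realpow h_def)
  then have 1: "real m * h < real m * ln 32 + ln 2 + (real m + 1) * h / 2 + 2 * h"
  proof -
    have "H / 4 < (real m + 1) * h / 2" using m'(2) by linarith
    then show ?thesis using \<open>real m * h \<le> _\<close> by linarith
  qed
  \<comment> \<open>Since m is at least 10, the stray h / 2 + 2 h is at most m h / 4. What remains,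
    m h / 4, is at least 5 / 4 of m ln 32, and the surplus exceeds ln 2.\<close>
  have "10 * h \<le> real m * h" using m10 h by (intro mult_right_mono) auto
  moreover have "(real m + 1) * h / 2 = real m * h / 2 + h / 2" by (simp add: field_simps)
  ultimately have 2: "real m * h / 4 < real m * ln 32 + ln 2"
    using 1 by linarith
  have "real m * (5 * ln 32) \<le> real m * h"
    using large by (intro mult_left_mono) (auto simp: h_def)
  with 2 have 3: "real m * ln 32 / 4 < ln 2" by simp
  have "ln 2 \<le> ln (32::real)" by simp
  moreover have "10 * ln (32::real) \<le> real m * ln 32"
    using m10 by (intro mult_right_mono) auto
  moreover have "ln (2::real) > 0" by simp
  ultimately show False using 3 by linarith
qed

section \<open>Pigeonhole on the directions\<close>

lemma prime_factors_subset_radical: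
  assumes "(a, b, c) \<in> abc_class r"
  shows "prime_factors a \<subseteq> prime_factors r" "prime_factors b \<subseteq> prime_factors r"
    "prime_factors c \<subseteq> prime_factors r"
proof -
  have nz: "a * b * c \<noteq> 0" and r: "r = (\<Prod>p\<in>prime_factors (a * b * c). p)"
    using assms by (auto simp: abc_class_def abc_equation_def abc_radical_def)
  have "r \<noteq> 0" unfolding r by (auto dest: in_prime_factors_imp_prime)
  have "p \<in> prime_factors r" if "p \<in> prime_factors (a * b * c)" for p
  proof (rule prime_factorsI)
    show "r \<noteq> 0" by fact
    show "prime p" using that by (rule in_prime_factors_imp_prime)
    show "p dvd r" unfolding r using that by (rule dvd_prodI[OF finite_set_mset])
  qed
  then have sub: "prime_factors (a * b * c) \<subseteq> prime_factors r" by blast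
  show "prime_factors a \<subseteq> prime_factors r" "prime_factors b \<subseteq> prime_factors r"
    "prime_factors c \<subseteq> prime_factors r"
    by (rule order_trans[OF dvd_prime_factors[OF nz] sub], simp)+
qed

lemma abs_diff_le_if_floor_eq:
  fixes x y :: real
  assumes "\<lfloor>M * x\<rfloor> = \<lfloor>M * y\<rfloor>" "M > 0"
  shows "\<bar>x - y\<bar> \<le> 1 / M"
proof -
  have "\<bar>M * x - M * y\<bar> \<le> 1"
    using assms(1) by linarith
  then have "M * \<bar>x - y\<bar> \<le> 1"
    using assms(2) by (simp add: abs_mult flip: right_diff_distrib)
  then show ?thesis using assms(2) by (simp add: field_simps)
qed

lemma infinite_triples_unbounded:
  fixes T :: "(nat \<times> nat \<times> nat) set"
  assumes "infinite T" "\<And>a b c. (a, b, c) \<in> T \<Longrightarrow> c = a + b"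
  obtains a b c where "(a, b, c) \<in> T" "N \<le> c"
proof -
  have "\<not> T \<subseteq> {..N} \<times> {..N} \<times> {..N}"
    using assms(1) by (meson finite_SigmaI finite_atMost finite_subset)
  then obtain a b c where "(a, b, c) \<in> T" "\<not> (a \<le> N \<and> b \<le> N \<and> c \<le> N)" by auto
  then show ?thesis using assms(2)[of a b c] that[of a b c] by auto
qed

text \<open>The directions of a triple form a point of the unit cube of dimension 3 card S. Of
  finitely many cells of side 1 / M, one holds infinitely many triples, hence two that
  \<open>no_far_solution_in_direction\<close> excludes.\<close>

lemma finite_abc_class: "finite (abc_class r)"
proof (rule ccontr)
  assume inf: "infinite (abc_class r)"
  define S where "S = prime_factors r"
  have S: "finite S" "\<And>p. p \<in> S \<Longrightarrow> prime p"
    by (auto simp: S_def)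
  \<comment> \<open>The factor 16 brings the error \<open>card S * (ln C / M)\<close> down to ln C /
    16; the added 1 keeps \<open>M\<close> positive when \<open>S\<close> is empty.\<close>
  define M where "M = 16 * real (card S) + 1"
  \<comment> \<open>Restricting the function to \<open>S\<close> makes it extensional, so that all
    cells lie in a finite \<open>PiE\<close> set.\<close>
  define cell where "cell = (\<lambda>(a, b, c). \<lambda>p\<in>S.
      (\<lfloor>M * direction c a p\<rfloor>, \<lfloor>M * direction c b p\<rfloor>, \<lfloor>M * direction c c p\<rfloor>))"
  have M: "M > 0" "16 * real (card S) \<le> M" by (auto simp: M_def add_nonneg_pos)
  have eqn: "c = a + b" "0 < a" "0 < b" "coprime a b" if "(a, b, c) \<in> abc_class r" for a b c
  proof -
    have "c = a + b \<and> 0 < a \<and> 0 < b \<and> gcd a b = 1"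
      using that by (auto simp: abc_class_def abc_equation_def)
    then show "c = a + b" "0 < a" "0 < b" "coprime a b"
      by (simp_all only: coprime_iff_gcd_eq_1)
  qed
  define I where "I = {0..\<lfloor>M\<rfloor>}"
  have "cell E \<in> S \<rightarrow>\<^sub>E I \<times> I \<times> I" if "E \<in> abc_class r" for E
  proof -
    obtain a b c where E: "E = (a, b, c)" by (cases E)
    note e = eqn[OF that[unfolded E]]
    have I: "\<lfloor>M * direction c x p\<rfloor> \<in> I" if "p \<in> S" "0 < x" "x \<le> c" for x p
    proof -
      have "1 < c" using e by simp
      then have "0 \<le> direction c x p" "direction c x p \<le> 1"
        using direction_bounds[OF S(2)] that by simp_all
      then have "0 \<le> M * direction c x p" "M * direction c x p \<le> M"
        using M by (auto simp: mult_left_le)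
      then show ?thesis by (simp add: I_def floor_mono)
    qed
    have "0 < c" "a \<le> c" "b \<le> c" using e by simp_all
    then show ?thesis unfolding E cell_def using I e(2,3) by simp
  qed
  then have "cell ` abc_class r \<subseteq> S \<rightarrow>\<^sub>E I \<times> I \<times> I" by blast
  moreover have "finite (S \<rightarrow>\<^sub>E I \<times> I \<times> I)"
    using S by (intro finite_PiE) (auto simp: I_def)
  ultimately have "finite (cell ` abc_class r)" by (rule finite_subset)
  from pigeonhole_infinite[OF inf this]
  obtain E0 where E0: "infinite {E \<in> abc_class r. cell E = cell E0}" by auto
  define T where "T = {E \<in> abc_class r. cell E = cell E0}"
  have T: "infinite T" "T \<subseteq> abc_class r" "\<And>E F. E \<in> T \<Longrightarrow> F \<in> T \<Longrightarrow> cell E = cell F"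
    using E0 by (auto simp: T_def)
  have Teqn: "c = a + b" if "(a, b, c) \<in> T" for a b c
    using eqn(1)[OF subsetD[OF T(2) that]] .
  \<comment> \<open>The thresholds \<open>32 ^ 5\<close> and \<open>c ^ 20\<close> turn into the two
    required size conditions on taking logarithms.\<close>
  obtain a b c where abc: "(a, b, c) \<in> T" "32 ^ 5 \<le> c"
    by (rule infinite_triples_unbounded[OF T(1) Teqn])
  obtain A B C where ABC: "(A, B, C) \<in> T" "c ^ 20 \<le> C"
    by (rule infinite_triples_unbounded[OF T(1) Teqn])
  have mem: "(a, b, c) \<in> abc_class r" "(A, B, C) \<in> abc_class r" using abc ABC T by auto
  note e = eqn[OF mem(1)] and E = eqn[OF mem(2)]
  have cell: "cell (a, b, c) p = cell (A, B, C) p" for p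
    using T(3)[OF abc(1) ABC(1)] by simp
  have close: "\<bar>direction c a p - direction C A p\<bar> \<le> 1 / M"
      "\<bar>direction c b p - direction C B p\<bar> \<le> 1 / M"
      "\<bar>direction c c p - direction C C p\<bar> \<le> 1 / M" if "p \<in> S" for p
    by (rule abs_diff_le_if_floor_eq[OF _ M(1)], use cell[of p] that in \<open>simp add: cell_def\<close>)+
  note pf = prime_factors_subset_radical[OF mem(1), folded S_def]
    prime_factors_subset_radical[OF mem(2), folded S_def]
  have large: "5 * ln 32 \<le> ln (real c)"
  proof -
    have "real (32 ^ 5) \<le> real c" using abc(2) by (simp only: of_nat_le_iff)
    then have "ln (32 ^ 5) \<le> ln (real c)" using e by (subst ln_le_cancel_iff) auto
    moreover have "ln ((32::real) ^ 5) = 5 * ln 32" by (subst ln_realpow) auto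
    ultimately show ?thesis by simp
  qed
  have far: "20 * ln (real c) \<le> ln (real C)"
  proof -
    have "real (c ^ 20) \<le> real C" using ABC(2) by (simp only: of_nat_le_iff)
    then have "ln (real c ^ 20) \<le> ln (real C)" using e E by (subst ln_le_cancel_iff) auto
    moreover have "ln (real c ^ 20) = 20 * ln (real c)" using e by (subst ln_realpow) auto
    ultimately show ?thesis by simp
  qed
  show False
    by (rule no_far_solution_in_direction[of S c a b C A B M]) (fact S e E(1-3) pf M close large far)+
qed

theorem mainTheorem1:
  fixes \<omega> :: nat and p :: "nat \<Rightarrow> nat"
  assumes "1 \<le> \<omega>"
    and "\<And>i. i \<in> {1..\<omega>} \<Longrightarrow> prime (p i)"
    and "strict_mono_on {1..\<omega>} p"
  shows "finite (abc_class (\<Prod>i=1..\<omega>. p i))"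
  by (rule finite_abc_class)

end
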